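(* Fix $m\ge 2$. The set $\mathcal P(\mathcal T^m)\subseteq\mathbb R^2$ is convex.
   Context: For $k\in\mathbb N$, $T^m_k$ is the torus $[k]^m$: the graph with vertex set $[k]^m$ in which $(x_1,\dots,x_m)$ and $(y_1,\dots,y_m)$ are adjacent iff $x_j\equiv y_j\pm1 \pmod k$ for exactly one coordinate $j$ and $x_i=y_i$ for all $i\ne j$. $\mathcal T^m$ is the sequence $(T^m_k)_{k\ge1}$. A balanced colouring of a graph is a partition of its vertex set into $R,B$ with $|R|=|B|$. A random walk moves at each step to a uniformly random neighbour; for a vertex set $S$, $P_2(S)$ is the probability that the random walk started at a uniformly random vertex of $S$ is in $S$ after step 1 and after step 2. For a sequence of graphs $\mathcal G=(G_k)$, $(x,y)\in\mathcal P(\mathcal G)$ iff for every $\epsilon>0$ there exist some $k$ and a balanced colouring $(R,B)$ of $G_k$ with $|P_2(R)-x|<\epsilon$ and $|P_2(B)-y|<\epsilon$. *)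

theory Defs
  imports
    "HOL-Number_Theory.Cong"
    "HOL-Probability.Probability_Mass_Function"
    "Graph_Theory.Pair_Digraph"
begin

text \<open>
  A finite simple graph is given by its vertices and its symmetric set of arcs
  (locale \<open>pair_graph\<close>).
\<close>

text \<open>Points of the torus are extensional functions on the coordinate set \<open>{1..m}\<close>.\<close>

definition torus_adj :: "nat \<Rightarrow> nat \<Rightarrow> (nat \<Rightarrow> nat) \<Rightarrow> (nat \<Rightarrow> nat) \<Rightarrow> bool" where
  "torus_adj m k x y \<longleftrightarrow>
     (\<exists>!j. j \<in> {1..m} \<and>
        ([int (x j) = int (y j) + 1] (mod int k) \<or> [int (x j) = int (y j) - 1] (mod int k)) \<and>
        (\<forall>i\<in>{1..m}. i \<noteq> j \<longrightarrow> x i = y i))"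

definition torus :: "nat \<Rightarrow> nat \<Rightarrow> (nat \<Rightarrow> nat) pair_pre_digraph" where
  "torus m k =
     \<lparr> pverts = ({1..m} \<rightarrow>\<^sub>E {1..k}),
       parcs = {(x, y). x \<in> ({1..m} \<rightarrow>\<^sub>E {1..k}) \<and> y \<in> ({1..m} \<rightarrow>\<^sub>E {1..k}) \<and> torus_adj m k x y} \<rparr>"

definition balanced_colouring :: "'a pair_pre_digraph \<Rightarrow> 'a set \<Rightarrow> 'a set \<Rightarrow> bool" where
  "balanced_colouring G R B \<longleftrightarrow> R \<union> B = pverts G \<and> R \<inter> B = {} \<and> card R = card B"

text \<open>
  \<open>pmf_of_set\<close> is unspecified on the empty set, so the next definition is only meaningful at
  vertices that have a neighbour.
\<close>

definition walk_step :: "'a pair_pre_digraph \<Rightarrow> 'a \<Rightarrow> 'a pmf" where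
  "walk_step G v = pmf_of_set {w. (v, w) \<in> parcs G}"

definition walk2 :: "'a pair_pre_digraph \<Rightarrow> 'a set \<Rightarrow> ('a \<times> 'a \<times> 'a) pmf" where
  "walk2 G S =
     bind_pmf (pmf_of_set S) (\<lambda>v0.
       bind_pmf (walk_step G v0) (\<lambda>v1.
         map_pmf (\<lambda>v2. (v0, v1, v2)) (walk_step G v1)))"

definition P2 :: "'a pair_pre_digraph \<Rightarrow> 'a set \<Rightarrow> real" where
  "P2 G S = measure_pmf.prob (walk2 G S) {(v0, v1, v2). v1 \<in> S \<and> v2 \<in> S}"

text \<open>Sequences of graphs are indexed by \<open>k \<ge> 1\<close>; the value at \<open>0\<close> is ignored.\<close>

definition P_region :: "(nat \<Rightarrow> 'a pair_pre_digraph) \<Rightarrow> (real \<times> real) set" where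
  "P_region G =
     {(x, y). \<forall>\<epsilon>>0. \<exists>k\<ge>1. \<exists>R B. balanced_colouring (G k) R B \<and>
        \<bar>P2 (G k) R - x\<bar> < \<epsilon> \<and> \<bar>P2 (G k) B - y\<bar> < \<epsilon>}"

text \<open>
  For \<open>k = 1\<close> and \<open>m \<ge> 2\<close> the torus is a single vertex without arcs, which has no balanced
  colouring; for \<open>k \<ge> 2\<close> every vertex has a neighbour.
\<close>

lemma torus_adj_sym: "torus_adj m k x y \<Longrightarrow> torus_adj m k y x"
proof -
  have "[int b = int a + 1] (mod int k) \<or> [int b = int a - 1] (mod int k)"
    if "[int a = int b + 1] (mod int k) \<or> [int a = int b - 1] (mod int k)" for a b :: nat
    using that
    by (smt (verit) cong_iff_dvd_diff cong_sym)
  then have eq: "([int (x j) = int (y j) + 1] (mod int k) \<or> [int (x j) = int (y j) - 1] (mod int k))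
     \<longleftrightarrow> ([int (y j) = int (x j) + 1] (mod int k) \<or> [int (y j) = int (x j) - 1] (mod int k))" for j
    by blast
  assume "torus_adj m k x y"
  then show ?thesis
    unfolding torus_adj_def eq by (simp add: eq_commute[of "y _"])
qed

lemma not_torus_adj_refl:
  assumes "m \<ge> 2"
  shows "\<not> torus_adj m k x x"
proof
  let ?Q = "\<lambda>j. [int (x j) = int (x j) + 1] (mod int k) \<or> [int (x j) = int (x j) - 1] (mod int k)"
  assume "torus_adj m k x x"
  then obtain j where j: "?Q j" and uniq: "\<And>i. i \<in> {1..m} \<Longrightarrow> ?Q i \<Longrightarrow> i = j"
    unfolding torus_adj_def by auto
  have "?Q i" for i
    using j by (auto simp: cong_iff_dvd_diff)
  with uniq have "1 = j" "2 = j"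
    using assms by auto
  then show False by simp
qed

lemma pair_graph_torus:
  assumes "m \<ge> 2"
  shows "pair_graph (torus m k)"
proof
  let ?V = "{1..m} \<rightarrow>\<^sub>E {1..k}"
  show "finite (pverts (torus m k))"
    by (simp add: torus_def finite_PiE)
  have "parcs (torus m k) \<subseteq> ?V \<times> ?V"
    by (auto simp: torus_def)
  moreover have "finite (?V \<times> ?V)"
    by (intro finite_cartesian_product finite_PiE) auto
  ultimately show "finite (parcs (torus m k))"
    by (rule finite_subset)
  show "symmetric (with_proj (torus m k))"
    unfolding symmetric_def
    by (auto intro!: symI simp: torus_def torus_adj_sym)
  show "\<And>e. e \<in> parcs (torus m k) \<Longrightarrow> fst e \<noteq> snd e"
    using not_torus_adj_refl[OF assms] by (auto simp: torus_def)
qed (auto simp: torus_def)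

lemma torus_has_neighbour:
  assumes "m \<ge> 1" "k \<ge> 2" "x \<in> pverts (torus m k)"
  shows "{y. (x, y) \<in> parcs (torus m k)} \<noteq> {}"
proof -
  have x: "x \<in> {1..m} \<rightarrow>\<^sub>E {1..k}"
    using assms by (simp add: torus_def)
  then have x1: "x 1 \<in> {1..k}"
    using assms by (auto simp: PiE_def Pi_def)
  define c where "c = (if x 1 = k then 1 else x 1 + 1)"
  have c: "c \<in> {1..k}" "c \<noteq> x 1" "[int (x 1) = int c - 1] (mod int k)"
    using x1 assms by (auto simp: c_def cong_iff_dvd_diff)
  define y where "y = x(1 := c)"
  have y: "y \<in> {1..m} \<rightarrow>\<^sub>E {1..k}"
    using x c assms by (auto simp: y_def PiE_def Pi_def extensional_def)
  have "torus_adj m k x y"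
    unfolding torus_adj_def
  proof (rule ex1I[of _ 1])
    show "1 \<in> {1..m} \<and> ([int (x 1) = int (y 1) + 1] (mod int k) \<or>
        [int (x 1) = int (y 1) - 1] (mod int k)) \<and> (\<forall>i\<in>{1..m}. i \<noteq> 1 \<longrightarrow> x i = y i)"
      using c assms by (auto simp: y_def)
  next
    fix j
    assume "j \<in> {1..m} \<and> ([int (x j) = int (y j) + 1] (mod int k) \<or>
        [int (x j) = int (y j) - 1] (mod int k)) \<and> (\<forall>i\<in>{1..m}. i \<noteq> j \<longrightarrow> x i = y i)"
    then have "j \<noteq> 1 \<Longrightarrow> x 1 = y 1"
      using assms by auto
    with c show "j = 1"
      by (auto simp: y_def)
  qed
  with x y show ?thesis
    by (auto simp: torus_def)
qed

end

theory Submission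
  imports Defs
begin

text \<open>
  A colouring of \<open>T\<^sub>k\<close> pulls back along the covering map \<open>T\<^sub>N \<rightarrow> T\<^sub>k\<close> for \<open>k dvd N\<close>, and the pull-back is
  balanced with the same values of \<open>P2\<close>, because the covering map sends the random walk to the random
  walk. Given colourings of \<open>T\<^sub>k\<close> and \<open>T\<^sub>l\<close>, colour the slab \<open>v 1 \<le> c\<close> of \<open>T\<^sub>N\<close> by the first pull-back and the
  rest by the second, where \<open>k * l\<close> divides \<open>c\<close> and \<open>N\<close>. Both slabs are balanced, and two steps of the walk
  notice the interfaces only from at most eight values of \<open>v 1\<close>, so \<open>P2\<close> of the new colouring differs
  by at most \<open>16 / N\<close> from the convex combination with weight \<open>c / N\<close>.
\<close>

section \<open>Push-forward of uniform distributions\<close>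

text \<open>Fibres of common size \<open>n\<close> give \<open>card A = card (f\<close> A) *
  n\<open>, so every image point receives mass\<close>n / card A = 1 / card (f \<open>A)\<close>.
  This is what turns a uniform direction into a uniform neighbour.\<close>

lemma map_pmf_of_set_const_fibre:
  assumes "finite A" "A \<noteq> {}" and fib: "\<And>y. y \<in> f ` A \<Longrightarrow> card {x \<in> A. f x = y} = n"
  shows "map_pmf f (pmf_of_set A) = pmf_of_set (f ` A)"
proof (rule pmf_eqI)
  fix y
  have "card A = (\<Sum>x\<in>A. 1)" by simp
  also have "\<dots> = (\<Sum>y\<in>f ` A. of_nat (card {x \<in> A. f x = y}) * (1::nat))"
    using assms by (intro sum_fun_comp[where f = "\<lambda>_. 1"]) auto
  also have "\<dots> = card (f ` A) * n"
    using fib by simp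
  finally have cA: "card A = card (f ` A) * n" .
  have "card A > 0" using assms by (simp add: card_gt_0_iff)
  then have n: "n > 0" using cA by (cases n) auto
  have *: "A \<inter> f -` {y} = {x \<in> A. f x = y}" by auto
  have "pmf (map_pmf f (pmf_of_set A)) y = card {x \<in> A. f x = y} / card A"
    using assms by (simp add: pmf_map measure_pmf_of_set *)
  also have "\<dots> = indicator (f ` A) y / card (f ` A)"
  proof (cases "y \<in> f ` A")
    case True
    then show ?thesis using fib n by (simp add: cA)
  next
    case False
    then have e: "{x \<in> A. f x = y} = {}" by auto
    show ?thesis unfolding e using False by simp
  qed
  also have "\<dots> = pmf (pmf_of_set (f ` A)) y"
    using assms by simp
  finally show "pmf (map_pmf f (pmf_of_set A)) y = pmf (pmf_of_set (f ` A)) y" .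
qed

section \<open>Residues, the covering map and unit moves\<close>

text \<open>The representative of a residue class modulo \<open>k\<close> in \<open>{1..k}\<close>; only meaningful for \<open>x \<ge> 1\<close>,
  since \<open>0 - 1\<close> truncates.\<close>

definition red :: "nat \<Rightarrow> nat \<Rightarrow> nat" where
  "red k x = (x - 1) mod k + 1"

text \<open>The covering map onto the torus of side \<open>k\<close>. The formula does not mention
  the side \<open>N\<close> of the covering torus, so one map serves every multiple of
  \<open>k\<close>.\<close>

definition torus_proj :: "nat \<Rightarrow> nat \<Rightarrow> (nat \<Rightarrow> nat) \<Rightarrow> nat \<Rightarrow> nat" where
  "torus_proj m k x = (\<lambda>i\<in>{1..m}. red k (x i))"

text \<open>A direction is a coordinate together with a sign, \<open>True\<close> meaning forward. A
  backward step adds \<open>k - 1\<close>, which keeps the arithmetic in the naturals free of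
  truncation.\<close>

definition move :: "nat \<Rightarrow> (nat \<Rightarrow> nat) \<Rightarrow> nat \<times> bool \<Rightarrow> nat \<Rightarrow> nat" where
  "move k x d = x(fst d := red k (x (fst d) + (if snd d then 1 else k - 1)))"

lemma red_range: "k \<ge> 1 \<Longrightarrow> red k x \<in> {1..k}"
  by (simp add: red_def Suc_leI)

lemma red_cong: "x \<ge> 1 \<Longrightarrow> [red k x = x] (mod k)"
  using cong_add_rcancel_nat[of "(x - 1) mod k" 1 "x - 1" k] by (simp add: red_def)

lemma red_unique:
  assumes "r \<in> {1..k}" "[r = x] (mod k)" "x \<ge> 1"
  shows "red k x = r"
proof -
  have "[r - 1 = x - 1] (mod k)"
    using assms cong_add_rcancel_nat[of "r - 1" 1 "x - 1" k] by simp
  moreover have "(r - 1) mod k = r - 1"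
    using assms by (intro mod_less) auto
  ultimately have "(x - 1) mod k = r - 1"
    by (simp add: unique_euclidean_semiring_class.cong_def)
  then show ?thesis using assms by (simp add: red_def)
qed

lemma red_cong_eq: "x \<ge> 1 \<Longrightarrow> y \<ge> 1 \<Longrightarrow> k \<ge> 1 \<Longrightarrow> red k x = red k y \<longleftrightarrow> [x = y] (mod k)"
  by (metis red_cong red_range red_unique cong_sym cong_trans)

text \<open>Since \<open>k dvd N\<close>, both \<open>N - 1\<close> and \<open>k - 1\<close>
  represent -1 modulo \<open>k\<close>; reduction modulo \<open>N\<close> does not change residues
  modulo \<open>k\<close>.\<close>

lemma red_red_add:
  assumes "k dvd N" "x \<ge> 1" "N \<ge> 1" "k \<ge> 1"
  shows "red k (red N (x + (if s then 1 else N - 1))) = red k (red k x + (if s then 1 else k - 1))"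
proof -
  let ?d = "\<lambda>k. if s then 1 else k - 1 :: nat"
  have "[red N (x + ?d N) = x + ?d N] (mod k)"
    using red_cong[of "x + ?d N" N] assms by (auto intro: cong_dvd_modulus_nat)
  moreover have "[?d N = ?d k] (mod k)"
  proof -
    have "[N = k] (mod k)"
      using assms(1) by (simp add: unique_euclidean_semiring_class.cong_def)
    then have "[N - 1 + 1 = k - 1 + 1] (mod k)"
      using assms by simp
    then show ?thesis by (metis cong_add_rcancel_nat cong_refl)
  qed
  then have "[x + ?d N = red k x + ?d k] (mod k)"
    using red_cong[OF assms(2)] by (intro cong_add) (auto simp: cong_sym)
  ultimately have "[red N (x + ?d N) = red k x + ?d k] (mod k)"
    by (rule cong_trans)
  moreover have "red N (x + ?d N) \<ge> 1" "red k x + ?d k \<ge> 1"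
    by (auto simp: red_def)
  ultimately show ?thesis using assms by (simp only: red_cong_eq)
qed

lemma torus_proj_mem: "k \<ge> 1 \<Longrightarrow> torus_proj m k x \<in> {1..m} \<rightarrow>\<^sub>E {1..k}"
  using red_range by (auto simp: torus_proj_def)

lemma move_mem:
  "k \<ge> 1 \<Longrightarrow> x \<in> {1..m} \<rightarrow>\<^sub>E {1..k} \<Longrightarrow> d \<in> {1..m} \<times> UNIV \<Longrightarrow> move k x d \<in> {1..m} \<rightarrow>\<^sub>E {1..k}"
  using red_range[of k] by (auto simp: move_def PiE_def Pi_def extensional_def)

text \<open>Equivariance of the covering map: the same direction \<open>d\<close> is used upstairs
  and downstairs. Only coordinate \<open>fst d\<close> needs an argument, and there it is
  \<open>red_red_add\<close>.\<close>

lemma torus_proj_move: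
  assumes "k dvd N" "N \<ge> 1" "k \<ge> 1" "x \<in> {1..m} \<rightarrow>\<^sub>E {1..N}" "d \<in> {1..m} \<times> UNIV"
  shows "torus_proj m k (move N x d) = move k (torus_proj m k x) d"
proof
  fix i
  have "x (fst d) \<ge> 1" using assms by (auto simp: PiE_def Pi_def)
  then show "torus_proj m k (move N x d) i = move k (torus_proj m k x) d i"
    using assms red_red_add[of k N "x (fst d)" "snd d"] by (auto simp: torus_proj_def move_def)
qed

section \<open>The random walk as a uniformly random direction\<close>

lemma cong_pred_iff:
  assumes "k \<ge> 1"
  shows "[int b = int a - 1] (mod int k) \<longleftrightarrow> [b = a + (k - 1)] (mod k)"
proof -
  have "[int a - 1 = int (a + (k - 1))] (mod int k)"
    using assms by (simp add: cong_iff_dvd_diff of_nat_diff)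
  then show ?thesis
    by (metis cong_int_iff cong_sym cong_trans)
qed

lemma cong_succ_iff: "[int b = int a + 1] (mod int k) \<longleftrightarrow> [b = a + 1] (mod k)"
  by (metis cong_int_iff of_nat_1 of_nat_add)

text \<open>Neither 1 nor \<open>k - 1\<close> vanishes modulo \<open>k\<close> when
  \<open>k \<ge> 2\<close>. Hence a move really changes its coordinate, so the coordinate can be
  recovered from the result.\<close>

lemma red_add_neq:
  assumes "k \<ge> 2" "a \<in> {1..k}"
  shows "red k (a + (if s then 1 else k - 1)) \<noteq> a"
proof
  let ?d = "if s then 1 else k - 1 :: nat"
  assume "red k (a + ?d) = a"
  then have "[a = a + ?d] (mod k)"
    using red_cong[of "a + ?d" k] assms by auto
  then have "[0 = ?d] (mod k)"
    by (metis add.right_neutral cong_add_lcancel_nat)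
  then show False
    using assms cong_less_modulus_unique_nat[of 0 ?d k] by (simp split: if_splits)
qed

lemma torus_nbrs:
  assumes "k \<ge> 2" "v \<in> {1..m} \<rightarrow>\<^sub>E {1..k}"
  shows "{w. (v, w) \<in> parcs (torus m k)} = move k v ` ({1..m} \<times> UNIV)"
proof (intro equalityI subsetI)
  fix w assume "w \<in> {w. (v, w) \<in> parcs (torus m k)}"
  then have w: "w \<in> {1..m} \<rightarrow>\<^sub>E {1..k}" and "torus_adj m k w v"
    by (auto simp: torus_def torus_adj_sym)
  then obtain j where j: "j \<in> {1..m}" and
    c: "[int (w j) = int (v j) + 1] (mod int k) \<or> [int (w j) = int (v j) - 1] (mod int k)"
    and eq: "\<forall>i\<in>{1..m}. i \<noteq> j \<longrightarrow> w i = v i"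
    unfolding torus_adj_def by (elim ex1E) blast
  have wj: "w j \<in> {1..k}" "v j \<in> {1..k}" using w assms j by (auto simp: PiE_def Pi_def)
  have "k \<ge> 1" using assms by simp
  then have "\<exists>s. [w j = v j + (if s then 1 else k - 1)] (mod k)"
    using c unfolding cong_pred_iff[OF \<open>k \<ge> 1\<close>] cong_succ_iff by metis
  then obtain s where "[w j = v j + (if s then 1 else k - 1)] (mod k)" ..
  then have "red k (v j + (if s then 1 else k - 1)) = w j"
    using wj by (intro red_unique) auto
  \<comment> \<open>The two points agree at \<open>j\<close> by the choice of \<open>s\<close>, at
    the other coordinates by adjacency, and outside \<open>{1..m}\<close> by extensionality.\<close>
  then have "w = move k v (j, s)"
    using eq w assms j by (auto simp: move_def fun_eq_iff PiE_def extensional_def)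
  then show "w \<in> move k v ` ({1..m} \<times> UNIV)" using j by auto
next
  fix w assume "w \<in> move k v ` ({1..m} \<times> UNIV)"
  then obtain j s where j: "j \<in> {1..m}" and w: "w = move k v (j, s)" by auto
  have wm: "w \<in> {1..m} \<rightarrow>\<^sub>E {1..k}"
    using move_mem[of k v m "(j, s)"] assms j w by auto
  have vj: "v j \<in> {1..k}" using assms j by (auto simp: PiE_def Pi_def)
  have wj: "w j = red k (v j + (if s then 1 else k - 1))" by (simp add: w move_def)
  have "[w j = v j + (if s then 1 else k - 1)] (mod k)"
    unfolding wj using vj by (intro red_cong) auto
  then have c: "[int (w j) = int (v j) + 1] (mod int k) \<or> [int (w j) = int (v j) - 1] (mod int k)"
    using assms by (auto simp: cong_pred_iff cong_succ_iff split: if_splits)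
  \<comment> \<open>This gives the uniqueness in \<open>torus_adj\<close>: a second witness
    \<open>i\<close> would force \<open>w j = v j\<close>.\<close>
  have ne: "w j \<noteq> v j" using red_add_neq[of k "v j" s] assms vj wj by simp
  have "torus_adj m k w v"
    unfolding torus_adj_def
  proof (rule ex1I[of _ j])
    show "j \<in> {1..m} \<and> ([int (w j) = int (v j) + 1] (mod int k) \<or>
        [int (w j) = int (v j) - 1] (mod int k)) \<and> (\<forall>i\<in>{1..m}. i \<noteq> j \<longrightarrow> w i = v i)"
      using j c by (auto simp: w move_def)
  next
    fix i
    assume "i \<in> {1..m} \<and> ([int (w i) = int (v i) + 1] (mod int k) \<or>
        [int (w i) = int (v i) - 1] (mod int k)) \<and> (\<forall>l\<in>{1..m}. l \<noteq> i \<longrightarrow> w l = v l)"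
    then show "i = j" using ne j by metis
  qed
  then show "w \<in> {w. (v, w) \<in> parcs (torus m k)}"
    using torus_adj_sym assms wm by (auto simp: torus_def)
qed

text \<open>For \<open>k = 2\<close> the two directions of a coordinate coincide, but the walk is still uniform
  over directions.\<close>

lemma walk_step_torus:
  assumes "k \<ge> 2" "m \<ge> 1" "v \<in> {1..m} \<rightarrow>\<^sub>E {1..k}"
  shows "walk_step (torus m k) v = map_pmf (move k v) (pmf_of_set ({1..m} \<times> UNIV))"
  unfolding walk_step_def torus_nbrs[OF assms(1,3)]
proof (rule map_pmf_of_set_const_fibre[symmetric, where n = "if k = 2 then 2 else 1"])
  show "finite ({1..m} \<times> (UNIV :: bool set))" by simp
  show "{1..m} \<times> (UNIV :: bool set) \<noteq> {}" using assms by auto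
  fix y assume "y \<in> move k v ` ({1..m} \<times> UNIV)"
  then obtain j s where j: "j \<in> {1..m}" and y: "y = move k v (j, s)" by auto
  let ?d = "\<lambda>s. if s then 1 else k - 1 :: nat"
  have v: "v i \<in> {1..k}" if "i \<in> {1..m}" for i using assms that by (auto simp: PiE_def Pi_def)
  have dir: "red k (v j + ?d t) = red k (v j + ?d s) \<longleftrightarrow> k = 2 \<or> t = s" for t
  proof -
    have "red k (v j + ?d t) = red k (v j + ?d s) \<longleftrightarrow> [v j + ?d t = v j + ?d s] (mod k)"
      using v[OF j] assms by (intro red_cong_eq) auto
    also have "\<dots> \<longleftrightarrow> [?d t = ?d s] (mod k)" by (rule cong_add_lcancel_nat)
    \<comment> \<open>Both increments lie below \<open>k\<close>, so congruence is equality;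
      opposite signs agree exactly when \<open>1 = k - 1\<close>.\<close>
    also have "\<dots> \<longleftrightarrow> ?d t = ?d s"
      using assms by (auto dest: cong_less_modulus_unique_nat split: if_splits)
    also have "\<dots> \<longleftrightarrow> k = 2 \<or> t = s" using assms by auto
    finally show ?thesis .
  qed
  have mv1: "move k v (i, t) = y \<longleftrightarrow> i = j \<and> (k = 2 \<or> t = s)" if i: "i \<in> {1..m}" for i t
  proof (cases "i = j")
    case True
    then show ?thesis using dir[of t] by (auto simp: y move_def fun_eq_iff)
  next
    case False
    then have "move k v (i, t) i \<noteq> y i"
      using red_add_neq[OF assms(1) v[OF i], of t] by (simp add: y move_def)
    then show ?thesis using False by auto
  qed
  have mv: "x \<in> {1..m} \<times> UNIV \<and> move k v x = y \<longleftrightarrow> x \<in> {j} \<times> (if k = 2 then UNIV else {s})" for x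
  proof (cases x)
    case (Pair i t)
    show ?thesis
    proof (cases "i \<in> {1..m}")
      case True
      show ?thesis unfolding Pair using True by (simp add: mv1[OF True])
    next
      case False
      with j show ?thesis unfolding Pair by auto
    qed
  qed
  have "{x \<in> {1..m} \<times> UNIV. move k v x = y} = {j} \<times> (if k = 2 then UNIV else {s})"
    by (intro set_eqI) (simp only: mem_Collect_eq mv)
  then show "card {x \<in> {1..m} \<times> UNIV. move k v x = y} = (if k = 2 then 2 else 1)"
    by (simp add: card_cartesian_product)
qed

lemma set_walk_step_torus:
  assumes "k \<ge> 2" "m \<ge> 1" "v \<in> {1..m} \<rightarrow>\<^sub>E {1..k}"
  shows "set_pmf (walk_step (torus m k) v) = move k v ` ({1..m} \<times> UNIV)"
  using assms by (simp add: walk_step_torus)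

text \<open>Both walks choose from the same set of directions, and the covering map commutes with
  each move. Working with directions instead of neighbours also covers \<open>k = 2 < N\<close>,
  where the degrees differ.\<close>

lemma walk_step_torus_proj:
  assumes "k dvd N" "k \<ge> 2" "N \<ge> 2" "m \<ge> 1" "v \<in> {1..m} \<rightarrow>\<^sub>E {1..N}"
  shows "walk_step (torus m k) (torus_proj m k v) = map_pmf (torus_proj m k) (walk_step (torus m N) v)"
proof -
  have "walk_step (torus m k) (torus_proj m k v) =
      map_pmf (move k (torus_proj m k v)) (pmf_of_set ({1..m} \<times> UNIV))"
    using assms by (intro walk_step_torus torus_proj_mem) auto
  also have "\<dots> = map_pmf (\<lambda>d. torus_proj m k (move N v d)) (pmf_of_set ({1..m} \<times> UNIV))"
    using assms by (intro map_pmf_cong) (auto simp: torus_proj_move)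
  also have "\<dots> = map_pmf (torus_proj m k) (walk_step (torus m N) v)"
    using assms by (simp add: walk_step_torus map_pmf_comp)
  finally show ?thesis .
qed

section \<open>Staying for two steps from a fixed vertex\<close>

text \<open>The contribution of one starting vertex to \<open>P2\<close>. It is defined for every
  \<open>v\<close>, inside \<open>S\<close> or not.\<close>

definition stay2 :: "'a pair_pre_digraph \<Rightarrow> 'a set \<Rightarrow> 'a \<Rightarrow> real" where
  "stay2 G S v = measure_pmf.prob
     (bind_pmf (walk_step G v) (\<lambda>v1. map_pmf (\<lambda>v2. (v1, v2)) (walk_step G v1))) (S \<times> S)"

lemma stay2_range: "0 \<le> stay2 G S v" "stay2 G S v \<le> 1"
  by (simp_all add: stay2_def)

lemma P2_range: "0 \<le> P2 G S" "P2 G S \<le> 1"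
  by (simp_all add: P2_def)

lemma P2_eq_sum:
  assumes "finite S" "S \<noteq> {}"
  shows "P2 G S = (\<Sum>v\<in>S. stay2 G S v) / card S"
proof -
  let ?A = "{(v0, v1, v2). v1 \<in> S \<and> v2 \<in> S}"
  let ?f = "\<lambda>v0. bind_pmf (walk_step G v0) (\<lambda>v1. map_pmf (\<lambda>v2. (v0, v1, v2)) (walk_step G v1))"
  \<comment> \<open>An event is encoded as the value \<open>True\<close> of a boolean distribution,
    so that the pointwise formula for a bind over a uniform distribution applies.\<close>
  have *: "pmf (map_pmf (\<lambda>x. x \<in> X) p) True = measure_pmf.prob p X" for p :: "'c pmf" and X
    by (simp add: pmf_map vimage_def)
  have "P2 G S = pmf (bind_pmf (pmf_of_set S) (\<lambda>v. map_pmf (\<lambda>x. x \<in> ?A) (?f v))) True"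
    unfolding P2_def walk2_def *[symmetric] map_bind_pmf ..
  also have "\<dots> = (\<Sum>v\<in>S. measure_pmf.prob (?f v) ?A) / card S"
    unfolding pmf_bind_pmf_of_set[OF assms(2,1)] * ..
  also have "(\<Sum>v\<in>S. measure_pmf.prob (?f v) ?A) = (\<Sum>v\<in>S. stay2 G S v)"
  proof (rule sum.cong[OF refl])
    fix v
    have "?f v = map_pmf (Pair v)
       (bind_pmf (walk_step G v) (\<lambda>v1. map_pmf (\<lambda>v2. (v1, v2)) (walk_step G v1)))"
      by (simp add: map_bind_pmf map_pmf_comp)
    then have "measure_pmf.prob (?f v) ?A = measure_pmf.prob
       (bind_pmf (walk_step G v) (\<lambda>v1. map_pmf (\<lambda>v2. (v1, v2)) (walk_step G v1))) (Pair v -` ?A)"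
      by simp
    also have "Pair v -` ?A = S \<times> S" by auto
    finally show "measure_pmf.prob (?f v) ?A = stay2 G S v" by (simp add: stay2_def)
  qed
  finally show ?thesis .
qed

text \<open>The covering map sends the two-step walk from \<open>v\<close> to the walk from its
  image. Only vertices reached after one or two steps are tested, so \<open>T\<close> has to agree
  with the pull-back of \<open>S\<close> just there; a glued set can thus be compared with either of
  its pieces.\<close>

lemma stay2_local:
  assumes k: "k dvd N" "k \<ge> 2" "N \<ge> 2" "m \<ge> 1" and v: "v \<in> {1..m} \<rightarrow>\<^sub>E {1..N}"
    and loc: "\<And>d e. d \<in> {1..m} \<times> UNIV \<Longrightarrow> e \<in> {1..m} \<times> UNIV \<Longrightarrow>
      (move N v d \<in> T \<longleftrightarrow> torus_proj m k (move N v d) \<in> S) \<and>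
      (move N (move N v d) e \<in> T \<longleftrightarrow> torus_proj m k (move N (move N v d) e) \<in> S)"
  shows "stay2 (torus m N) T v = stay2 (torus m k) S (torus_proj m k v)"
proof -
  let ?W = "walk_step (torus m N)" and ?V = "walk_step (torus m k)" and ?p = "torus_proj m k"
  let ?q = "bind_pmf (?W v) (\<lambda>v1. map_pmf (\<lambda>v2. (v1, v2)) (?W v1))"
  have sW: "set_pmf (?W v) = move N v ` ({1..m} \<times> UNIV)"
    using assms by (intro set_walk_step_torus)
  have mem: "w \<in> {1..m} \<rightarrow>\<^sub>E {1..N}" if "w \<in> set_pmf (?W v)" for w
    using that k(3) move_mem[OF _ v] by (force simp: sW)
  have "bind_pmf (?V (?p v)) (\<lambda>v1. map_pmf (\<lambda>v2. (v1, v2)) (?V v1)) =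
      bind_pmf (?W v) (\<lambda>w1. map_pmf (\<lambda>v2. (?p w1, v2)) (?V (?p w1)))"
    using assms by (simp add: walk_step_torus_proj bind_map_pmf)
  also have "\<dots> = bind_pmf (?W v) (\<lambda>w1. map_pmf (\<lambda>v2. (?p w1, v2)) (map_pmf ?p (?W w1)))"
    using k mem by (intro bind_pmf_cong refl) (simp add: walk_step_torus_proj)
  also have "\<dots> = map_pmf (map_prod ?p ?p) ?q"
    by (simp add: map_bind_pmf map_pmf_comp)
  finally have "stay2 (torus m k) S (?p v) = measure_pmf.prob ?q (map_prod ?p ?p -` (S \<times> S))"
    by (simp add: stay2_def)
  also have "\<dots> = measure_pmf.prob ?q (T \<times> T)"
  proof -
    have "x \<in> map_prod ?p ?p -` (S \<times> S) \<longleftrightarrow> x \<in> T \<times> T" if "x \<in> set_pmf ?q" for x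
    proof -
      from that obtain w1 w2 where x: "x = (w1, w2)" and w1: "w1 \<in> set_pmf (?W v)"
        and w2: "w2 \<in> set_pmf (?W w1)" by auto
      from w1 obtain d where d: "d \<in> {1..m} \<times> UNIV" "w1 = move N v d" by (auto simp: sW)
      from w2 obtain e where e: "e \<in> {1..m} \<times> UNIV" "w2 = move N w1 e"
        using set_walk_step_torus[OF k(3,4) mem[OF w1]] by auto
      show ?thesis using loc[OF d(1) e(1)] by (simp add: x d e)
    qed
    \<comment> \<open>The two events are equal only on the support of the walk, hence the
      almost-everywhere form.\<close>
    then show ?thesis
      by (intro measure_pmf.finite_measure_eq_AE) (auto simp: AE_measure_pmf_iff)
  qed
  finally show ?thesis by (simp add: stay2_def)
qed

section \<open>Counting fibres of the covering map over slabs\<close>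

text \<open>The interval consists of \<open>q - p\<close> blocks of length \<open>k\<close>, and
  each block \<open>{t * k<..(t + 1) * k}\<close> contains the single representative
  \<open>t * k + r\<close>.\<close>

lemma card_red_fibre:
  assumes "r \<in> {1..k}" "p \<le> q"
  shows "card {x \<in> {p * k<..q * k}. red k x = r} = q - p"
proof -
  have "{x \<in> {p * k<..q * k}. red k x = r} = (\<lambda>t. t * k + r) ` {p..<q}"
  proof (intro equalityI subsetI)
    fix x assume x: "x \<in> {x \<in> {p * k<..q * k}. red k x = r}"
    \<comment> \<open>The block index is the quotient of \<open>x - 1\<close>, not of
      \<open>x\<close>: representatives run from 1 to \<open>k\<close>, so a multiple of
      \<open>k\<close> ends its block.\<close>
    have "x - 1 = (x - 1) div k * k + (x - 1) mod k" by simp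
    moreover have "(x - 1) mod k + 1 = r" "x \<ge> 1" using x by (auto simp: red_def)
    ultimately have eq: "x = (x - 1) div k * k + r" by linarith
    have "p * k < x" "x \<le> q * k" "1 \<le> r" "r \<le> k" using x assms(1) by auto
    then have "p * k < (x - 1) div k * k + 1 * k" "(x - 1) div k * k < q * k"
      using eq by linarith+
    then have "p < (x - 1) div k + 1" "(x - 1) div k < q"
      unfolding add_mult_distrib[symmetric] mult_less_cancel2 by blast+
    then have "(x - 1) div k \<in> {p..<q}" by simp
    then show "x \<in> (\<lambda>t. t * k + r) ` {p..<q}" using eq by blast
  next
    fix x assume "x \<in> (\<lambda>t. t * k + r) ` {p..<q}"
    then obtain t where t: "p \<le> t" "t + 1 \<le> q" and x: "x = t * k + r" by auto
    have "p * k \<le> t * k" "(t + 1) * k \<le> q * k" using t by (intro mult_le_mono1; simp)+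
    then have "p * k < x" "x \<le> q * k" using assms(1) unfolding x add_mult_distrib atLeastAtMost_iff by linarith+
    moreover have "red k x = r" "r \<ge> 1"
      unfolding x using assms by (auto intro!: red_unique simp: unique_euclidean_semiring_class.cong_def)
    ultimately show "x \<in> {x \<in> {p * k<..q * k}. red k x = r}"
      by simp
  qed
  moreover have "inj_on (\<lambda>t. t * k + r) {p..<q}"
    using assms by (auto simp: inj_on_def)
  ultimately show ?thesis by (simp add: card_image)
qed

lemma prod_first:
  fixes a b :: nat
  assumes "m \<ge> 1"
  shows "(\<Prod>i\<in>{1..m}. if i = 1 then a else b) = a * b ^ (m - 1)"
proof -
  have "(\<Prod>i\<in>{1..m}. if i = 1 then a else b) = a * (\<Prod>i\<in>{1..m} - {1}. if i = 1 then a else b)"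
    using assms by (subst prod.remove[of _ 1]) auto
  also have "(\<Prod>i\<in>{1..m} - {1}. if i = 1 then a else b) = (\<Prod>i\<in>{1..m} - {1}. b)"
    by (intro prod.cong) auto
  finally show ?thesis using assms by simp
qed

text \<open>A condition on the first coordinate alone leaves a product set, so that cardinalities
  come from \<open>card_PiE\<close>.\<close>

lemma slab_eq_PiE:
  fixes m N :: nat
  assumes "m \<ge> 1" "X \<subseteq> {1..N}"
  shows "{v \<in> {1..m} \<rightarrow>\<^sub>E {1..N}. v 1 \<in> X} = (\<Pi>\<^sub>E i\<in>{1..m}. if i = 1 then X else {1..N})"
proof (intro equalityI subsetI)
  fix v assume "v \<in> {v \<in> {1..m} \<rightarrow>\<^sub>E {1..N}. v 1 \<in> X}"
  then have "v 1 \<in> X" "\<forall>i\<in>{1..m}. v i \<in> {1..N}" "v \<in> extensional {1..m}"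
    by (simp_all add: PiE_iff)
  then show "v \<in> (\<Pi>\<^sub>E i\<in>{1..m}. if i = 1 then X else {1..N})"
    unfolding PiE_iff by (metis (full_types))
next
  fix v assume "v \<in> (\<Pi>\<^sub>E i\<in>{1..m}. if i = 1 then X else {1..N})"
  then have *: "\<forall>i\<in>{1..m}. v i \<in> (if i = 1 then X else {1..N})" and ext: "v \<in> extensional {1..m}"
    unfolding PiE_iff by blast+
  have "1 \<in> {1..m}" using assms(1) by simp
  then have "v 1 \<in> X" using bspec[OF *] by fastforce
  moreover have "\<forall>i\<in>{1..m}. v i \<in> {1..N}" using * assms(2) by (metis subsetD)
  ultimately show "v \<in> {v \<in> {1..m} \<rightarrow>\<^sub>E {1..N}. v 1 \<in> X}"
    using ext by (simp only: PiE_iff mem_Collect_eq simp_thms)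
qed

lemma card_slab:
  fixes m N :: nat
  assumes "m \<ge> 1" "X \<subseteq> {1..N}"
  shows "card {v \<in> {1..m} \<rightarrow>\<^sub>E {1..N}. v 1 \<in> X} = card X * N ^ (m - 1)"
proof -
  have "card {v \<in> {1..m} \<rightarrow>\<^sub>E {1..N}. v 1 \<in> X} = (\<Prod>i\<in>{1..m}. card (if i = 1 then X else {1..N}))"
    unfolding slab_eq_PiE[OF assms] by (rule card_PiE) simp
  also have "\<dots> = (\<Prod>i\<in>{1..m}. if i = 1 then card X else N)"
    by (intro prod.cong) auto
  finally show ?thesis using assms(1) by (simp only: prod_first)
qed

text \<open>With \<open>p = a * k\<close>, \<open>q = b * k\<close> and \<open>N = n * k\<close>,
  every fibre of the covering map in the slab has \<open>(b - a) * n ^ (m - 1)\<close> points. The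
  stated factor is this number written without the quotients.\<close>

lemma sum_proj_slab:
  fixes f :: "(nat \<Rightarrow> nat) \<Rightarrow> real"
  assumes "m \<ge> 1" "k \<ge> 1" "k dvd p" "k dvd q" "k dvd N" "p \<le> q" "q \<le> N"
  shows "(\<Sum>v | v \<in> {1..m} \<rightarrow>\<^sub>E {1..N} \<and> v 1 \<in> {p<..q}. f (torus_proj m k v)) =
    (real q - real p) * real N ^ (m - 1) / real k ^ m * (\<Sum>u\<in>{1..m} \<rightarrow>\<^sub>E {1..k}. f u)"
proof -
  from assms obtain a b n where a: "p = a * k" and b: "q = b * k" and n: "N = n * k"
    by (metis dvd_def mult.commute)
  have ab: "a \<le> b" using assms by (simp add: a b)
  define B where "B = (\<lambda>i::nat. if i = 1 then {p<..q} else {1..N})"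
  have V: "{v. v \<in> {1..m} \<rightarrow>\<^sub>E {1..N} \<and> v 1 \<in> {p<..q}} = Pi\<^sub>E {1..m} B"
    unfolding B_def using assms by (intro slab_eq_PiE) auto
  have fin: "finite (Pi\<^sub>E {1..m} B)" by (intro finite_PiE) (auto simp: B_def)
  have cB: "card {x \<in> B i. red k x = r} = (if i = 1 then b - a else n)" if "r \<in> {1..k}" for i r
  proof -
    have "{1..N} = {0 * k<..n * k}" by (auto simp: n)
    then show ?thesis
      using card_red_fibre[OF that ab] card_red_fibre[OF that, of 0 n] by (simp add: B_def a b)
  qed
  have fib: "card {v \<in> Pi\<^sub>E {1..m} B. torus_proj m k v = u} = (b - a) * n ^ (m - 1)"
    if u: "u \<in> {1..m} \<rightarrow>\<^sub>E {1..k}" for u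
  proof -
    \<comment> \<open>The covering map acts coordinatewise, so its fibres are products of
      one-dimensional fibres.\<close>
    have "{v \<in> Pi\<^sub>E {1..m} B. torus_proj m k v = u} = (\<Pi>\<^sub>E i\<in>{1..m}. {x \<in> B i. red k x = u i})"
      using u by (auto simp: PiE_iff torus_proj_def extensional_def fun_eq_iff)
    then have "card {v \<in> Pi\<^sub>E {1..m} B. torus_proj m k v = u} =
        (\<Prod>i\<in>{1..m}. card {x \<in> B i. red k x = u i})"
      by (simp add: card_PiE)
    also have "\<dots> = (\<Prod>i\<in>{1..m}. if i = 1 then b - a else n)"
      using u by (intro prod.cong refl cB) (auto simp: PiE_iff)
    finally show ?thesis using assms(1) by (simp only: prod_first)
  qed
  have "(\<Sum>v\<in>Pi\<^sub>E {1..m} B. f (torus_proj m k v)) =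
      (\<Sum>u\<in>{1..m} \<rightarrow>\<^sub>E {1..k}. real (card {v \<in> Pi\<^sub>E {1..m} B. torus_proj m k v = u}) * f u)"
    by (rule sum_fun_comp[OF fin])
       (intro finite_PiE image_subsetI torus_proj_mem; use assms(2) in simp)+
  also have "\<dots> = (\<Sum>u\<in>{1..m} \<rightarrow>\<^sub>E {1..k}. real ((b - a) * n ^ (m - 1)) * f u)"
    by (intro sum.cong refl) (simp only: fib)
  also have "\<dots> = real ((b - a) * n ^ (m - 1)) * (\<Sum>u\<in>{1..m} \<rightarrow>\<^sub>E {1..k}. f u)"
    by (simp add: sum_distrib_left)
  also have "real ((b - a) * n ^ (m - 1)) = (real q - real p) * real N ^ (m - 1) / real k ^ m"
  proof -
    have "real k ^ m = real k * real k ^ (m - 1)"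
      using assms(1) by (simp add: power_eq_if)
    then show ?thesis using ab assms(2)
      by (simp add: a b n of_nat_diff power_mult_distrib field_simps)
  qed
  finally show ?thesis unfolding V .
qed

section \<open>Gluing two pulled-back sets along a slab\<close>

definition glue :: "nat \<Rightarrow> nat \<Rightarrow> nat \<Rightarrow> nat \<Rightarrow> nat \<Rightarrow> (nat \<Rightarrow> nat) set \<Rightarrow> (nat \<Rightarrow> nat) set \<Rightarrow> (nat \<Rightarrow> nat) set" where
  "glue m k l N c S T = {v \<in> {1..m} \<rightarrow>\<^sub>E {1..N}.
     if v 1 \<le> c then torus_proj m k v \<in> S else torus_proj m l v \<in> T}"

lemma finite_glue: "finite (glue m k l N c S T)"
proof (rule finite_subset)
  show "glue m k l N c S T \<subseteq> {1..m} \<rightarrow>\<^sub>E {1..N}" by (simp add: glue_def)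
  show "finite ({1..m} \<rightarrow>\<^sub>E {1..N})" by (simp add: finite_PiE)
qed

text \<open>Each slab is a constant-fibre cover, so its sum is a multiple of the sum downstairs. The
  weights \<open>f\<close> and \<open>g\<close> are kept general: constant 1 yields the cardinality,
  \<open>stay2\<close> yields the main term of \<open>P2\<close>.\<close>

lemma sum_glue:
  fixes f g :: "(nat \<Rightarrow> nat) \<Rightarrow> real"
  assumes "m \<ge> 1" "k \<ge> 1" "l \<ge> 1" "k dvd N" "l dvd N" "k dvd c" "l dvd c" "c \<le> N"
    and S: "S \<subseteq> {1..m} \<rightarrow>\<^sub>E {1..k}" and T: "T \<subseteq> {1..m} \<rightarrow>\<^sub>E {1..l}"
  shows "(\<Sum>v\<in>glue m k l N c S T. if v 1 \<le> c then f (torus_proj m k v) else g (torus_proj m l v)) =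
    real c * real N ^ (m - 1) / real k ^ m * (\<Sum>u\<in>S. f u) +
    (real N - real c) * real N ^ (m - 1) / real l ^ m * (\<Sum>u\<in>T. g u)"
proof -
  let ?V = "{1..m} \<rightarrow>\<^sub>E {1..N}"
  let ?V1 = "{v. v \<in> ?V \<and> v 1 \<in> {0<..c}}" and ?V2 = "{v. v \<in> ?V \<and> v 1 \<in> {c<..N}}"
  let ?h = "\<lambda>v. if v 1 \<le> c then f (torus_proj m k v) else g (torus_proj m l v)"
  let ?f = "\<lambda>u. if u \<in> S then f u else 0" and ?g = "\<lambda>u. if u \<in> T then g u else 0"
  have finV: "finite ?V" by (intro finite_PiE) auto
  have fin: "finite ?V1" "finite ?V2" using finV by (auto intro: rev_finite_subset)
  have v1: "1 \<le> v 1" "v 1 \<le> N" if "v \<in> ?V" for v using that assms(1) by (auto simp: PiE_iff)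
  have V: "?V = ?V1 \<union> ?V2" "?V1 \<inter> ?V2 = {}" using v1 by force+
  have "(\<Sum>v\<in>glue m k l N c S T. ?h v) = (\<Sum>v\<in>?V. if v \<in> glue m k l N c S T then ?h v else 0)"
    using finV by (intro sum.mono_neutral_cong_left) (auto simp: glue_def)
  \<comment> \<open>Extending by zero to all vertices makes the summand on each slab a function of
    the projected point.\<close>
  also have "\<dots> = (\<Sum>v\<in>?V1. if v \<in> glue m k l N c S T then ?h v else 0) +
      (\<Sum>v\<in>?V2. if v \<in> glue m k l N c S T then ?h v else 0)"
    by (subst V(1), rule sum.union_disjoint[OF fin V(2)])
  also have "(\<Sum>v\<in>?V1. if v \<in> glue m k l N c S T then ?h v else 0) = (\<Sum>v\<in>?V1. ?f (torus_proj m k v))"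
    by (intro sum.cong) (auto simp: glue_def)
  also have "\<dots> = (real c - real 0) * real N ^ (m - 1) / real k ^ m * (\<Sum>u\<in>{1..m} \<rightarrow>\<^sub>E {1..k}. ?f u)"
    using assms by (intro sum_proj_slab) auto
  also have "(\<Sum>u\<in>{1..m} \<rightarrow>\<^sub>E {1..k}. ?f u) = (\<Sum>u\<in>S. f u)"
    using S by (intro sum.mono_neutral_cong_right) (auto intro: finite_PiE)
  also have "(\<Sum>v\<in>?V2. if v \<in> glue m k l N c S T then ?h v else 0) = (\<Sum>v\<in>?V2. ?g (torus_proj m l v))"
    by (intro sum.cong) (auto simp: glue_def)
  also have "\<dots> = (real N - real c) * real N ^ (m - 1) / real l ^ m * (\<Sum>u\<in>{1..m} \<rightarrow>\<^sub>E {1..l}. ?g u)"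
    using assms by (intro sum_proj_slab) auto
  also have "(\<Sum>u\<in>{1..m} \<rightarrow>\<^sub>E {1..l}. ?g u) = (\<Sum>u\<in>T. g u)"
    using T by (intro sum.mono_neutral_cong_right) (auto intro: finite_PiE)
  finally show ?thesis by simp
qed

text \<open>Each slab is half filled because its piece is half of the small torus, so the two halves
  add up to half of \<open>N ^ m\<close>, wherever the cut \<open>c\<close> lies.\<close>

lemma card_glue:
  assumes "m \<ge> 1" "k \<ge> 1" "l \<ge> 1" "k dvd N" "l dvd N" "k dvd c" "l dvd c" "c \<le> N"
    and "S \<subseteq> {1..m} \<rightarrow>\<^sub>E {1..k}" "T \<subseteq> {1..m} \<rightarrow>\<^sub>E {1..l}"
    and S2: "2 * card S = k ^ m" and T2: "2 * card T = l ^ m"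
  shows "2 * card (glue m k l N c S T) = N ^ m"
proof -
  have cS: "real (card S) = real k ^ m / 2" "real (card T) = real l ^ m / 2"
    using arg_cong[OF S2, of real] arg_cong[OF T2, of real] by simp_all
  have "real (card (glue m k l N c S T)) =
      real c * real N ^ (m - 1) / real k ^ m * real (card S) +
      (real N - real c) * real N ^ (m - 1) / real l ^ m * real (card T)"
    using sum_glue[OF assms(1-10), of "\<lambda>_. 1" "\<lambda>_. 1"] by simp
  also have "\<dots> = real c * real N ^ (m - 1) / 2 + (real N - real c) * real N ^ (m - 1) / 2"
    using assms(2,3) unfolding cS by simp
  also have "\<dots> = real N * real N ^ (m - 1) / 2"
    by (simp add: field_simps)
  also have "real N * real N ^ (m - 1) = real N ^ m"
    using assms(1) by (simp add: power_eq_if)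
  finally have "real (2 * card (glue m k l N c S T)) = real (N ^ m)" by simp
  then show ?thesis by (simp only: of_nat_eq_iff)
qed

section \<open>The error caused by the interfaces\<close>

text \<open>Away from the values 1 and \<open>N\<close> no wrap-around occurs, so cyclic neighbours
  are ordinary neighbours. Adding on the other side avoids truncated subtraction.\<close>

lemma move_first:
  assumes "2 \<le> v 1" "v 1 < N"
  shows "v 1 \<le> move N v d 1 + 1" "move N v d 1 \<le> v 1 + 1"
proof -
  have succ: "red N (v 1 + 1) = v 1 + 1"
    using assms by (intro red_unique) auto
  have pred: "red N (v 1 + (N - 1)) = v 1 - 1"
  proof (rule red_unique)
    have "v 1 + (N - 1) = v 1 - 1 + N" using assms by simp
    then show "[v 1 - 1 = v 1 + (N - 1)] (mod N)"
      by (simp add: unique_euclidean_semiring_class.cong_def)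
  qed (use assms in auto)
  have "move N v d 1 \<in> {v 1 - 1, v 1, v 1 + 1}"
    unfolding move_def fun_upd_apply by (cases "1 = fst d"; cases "snd d"; simp add: succ pred del: One_nat_def)
  then show "v 1 \<le> move N v d 1 + 1" "move N v d 1 \<le> v 1 + 1" by auto
qed

text \<open>There are two interfaces: the cut between \<open>c\<close> and \<open>c + 1\<close>, and
  the wrap-around between \<open>N\<close> and 1. The excluded values are the two nearest on each
  side of each interface; from anywhere else two steps remain within one slab, and
  \<open>stay2_local\<close> applies.\<close>

lemma stay2_glue:
  assumes "m \<ge> 1" "k \<ge> 2" "l \<ge> 2" "k dvd N" "l dvd N" "N \<ge> 2"
    and v: "v \<in> {1..m} \<rightarrow>\<^sub>E {1..N}" "v 1 \<notin> {1, 2, c - 1, c, c + 1, c + 2, N - 1, N}"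
  shows "stay2 (torus m N) (glue m k l N c S T) v =
    (if v 1 \<le> c then stay2 (torus m k) S (torus_proj m k v) else stay2 (torus m l) T (torus_proj m l v))"
proof -
  have "1 \<le> v 1" "v 1 \<le> N" using v(1) assms(1) by (auto simp: PiE_iff)
  then have v1: "3 \<le> v 1" "v 1 + 2 \<le> N" and vc: "v 1 + 2 \<le> c \<or> c + 3 \<le> v 1"
    using v(2) by auto
  have near: "v 1 \<le> move N v d 1 + 1" "move N v d 1 \<le> v 1 + 1"
    "v 1 \<le> move N (move N v d) e 1 + 2" "move N (move N v d) e 1 \<le> v 1 + 2" for d e
  proof -
    show *: "v 1 \<le> move N v d 1 + 1" "move N v d 1 \<le> v 1 + 1"
      using v1 move_first[of v N d] by simp_all
    \<comment> \<open>After the first step the coordinate still lies between 2 and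
      \<open>N - 1\<close>, as \<open>move_first\<close> requires for the second.\<close>
    have "move N v d 1 \<le> move N (move N v d) e 1 + 1" "move N (move N v d) e 1 \<le> move N v d 1 + 1"
      using v1 * move_first[of "move N v d" N e] by simp_all
    then show "v 1 \<le> move N (move N v d) e 1 + 2" "move N (move N v d) e 1 \<le> v 1 + 2"
      using * by linarith+
  qed
  have mem: "move N v d \<in> {1..m} \<rightarrow>\<^sub>E {1..N}" "move N (move N v d) e \<in> {1..m} \<rightarrow>\<^sub>E {1..N}"
    if "d \<in> {1..m} \<times> UNIV" "e \<in> {1..m} \<times> UNIV" for d e
  proof -
    show *: "move N v d \<in> {1..m} \<rightarrow>\<^sub>E {1..N}"
      by (rule move_mem[OF _ v(1) that(1)]) (use assms in simp)
    show "move N (move N v d) e \<in> {1..m} \<rightarrow>\<^sub>E {1..N}"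
      by (rule move_mem[OF _ * that(2)]) (use assms in simp)
  qed
  show ?thesis
  proof (cases "v 1 \<le> c")
    case True
    then have c: "v 1 + 2 \<le> c" using vc by simp
    have le: "move N v d 1 \<le> c" "move N (move N v d) e 1 \<le> c" for d e
      using near(1,2)[of d] near(3,4)[of d e] c by linarith+
    have "stay2 (torus m N) (glue m k l N c S T) v = stay2 (torus m k) S (torus_proj m k v)"
    proof (rule stay2_local)
      fix d e assume de: "d \<in> {1..m} \<times> (UNIV :: bool set)" "e \<in> {1..m} \<times> (UNIV :: bool set)"
      show "(move N v d \<in> glue m k l N c S T \<longleftrightarrow> torus_proj m k (move N v d) \<in> S) \<and>
        (move N (move N v d) e \<in> glue m k l N c S T \<longleftrightarrow> torus_proj m k (move N (move N v d) e) \<in> S)"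
        using mem[OF de] by (simp only: glue_def mem_Collect_eq le if_True simp_thms)
    qed (use assms v in blast)+
    then show ?thesis using True by simp
  next
    case False
    then have c: "c + 3 \<le> v 1" using vc by simp
    have "\<not> move N v d 1 \<le> c" "\<not> move N (move N v d) e 1 \<le> c" for d e
      using near(1,2)[of d] near(3,4)[of d e] c by linarith+
    then have le: "(move N v d 1 \<le> c) = False" "(move N (move N v d) e 1 \<le> c) = False" for d e
      by simp_all
    have "stay2 (torus m N) (glue m k l N c S T) v = stay2 (torus m l) T (torus_proj m l v)"
    proof (rule stay2_local)
      fix d e assume de: "d \<in> {1..m} \<times> (UNIV :: bool set)" "e \<in> {1..m} \<times> (UNIV :: bool set)"
      show "(move N v d \<in> glue m k l N c S T \<longleftrightarrow> torus_proj m l (move N v d) \<in> T) \<and>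
        (move N (move N v d) e \<in> glue m k l N c S T \<longleftrightarrow> torus_proj m l (move N (move N v d) e) \<in> T)"
        using mem[OF de] by (simp only: glue_def mem_Collect_eq le if_False simp_thms)
    qed (use assms v in blast)+
    then show ?thesis using False by simp
  qed
qed

text \<open>Replacing \<open>stay2\<close> of the glued set by that of the piece below gives exactly
  the convex combination. The replacement costs at most 1 per vertex on at most
  \<open>8 * N ^ (m - 1)\<close> vertices, and the average is over \<open>N ^ m / 2\<close>
  vertices.\<close>

lemma P2_glue:
  assumes "m \<ge> 1" "k \<ge> 2" "l \<ge> 2" "k dvd N" "l dvd N" "k dvd c" "l dvd c" "c \<le> N" "N > 0"
    and S: "S \<subseteq> {1..m} \<rightarrow>\<^sub>E {1..k}" and T: "T \<subseteq> {1..m} \<rightarrow>\<^sub>E {1..l}"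
    and S2: "2 * card S = k ^ m" and T2: "2 * card T = l ^ m"
  shows "\<bar>P2 (torus m N) (glue m k l N c S T) -
    (c / N * P2 (torus m k) S + (1 - c / N) * P2 (torus m l) T)\<bar> \<le> 16 / N"
proof -
  let ?G = "glue m k l N c S T"
  let ?s = "stay2 (torus m N) ?G"
  let ?h = "\<lambda>v. if v 1 \<le> c then stay2 (torus m k) S (torus_proj m k v)
    else stay2 (torus m l) T (torus_proj m l v)"
  \<comment> \<open>For \<open>c\<close> near 0 or \<open>N\<close> some listed values leave
    \<open>{1..N}\<close>; the intersection makes \<open>card_slab\<close> applicable.\<close>
  define X where "X = {1, 2, c - 1, c, c + 1, c + 2, N - 1, N} \<inter> {1..N}"
  define D where "D = real N ^ (m - 1)"
  have N2: "N \<ge> 2" using assms dvd_imp_le[of k N] by linarith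
  have Nm: "real N ^ m = N * D" using assms(1) by (simp add: power_eq_if D_def)
  have D: "D > 0" using assms by (simp add: D_def)
  have cG: "2 * card ?G = N ^ m"
    using assms by (intro card_glue) auto
  then have cG': "real (card ?G) = N * D / 2"
    using arg_cong[OF cG, of real] Nm by simp
  have cS: "real (card S) = real k ^ m / 2" "real (card T) = real l ^ m / 2"
    using arg_cong[OF S2, of real] arg_cong[OF T2, of real] by simp_all
  have fin: "finite S" "finite T"
    using S T by (auto intro: finite_subset finite_PiE)
  have ne: "S \<noteq> {}" "T \<noteq> {}" "?G \<noteq> {}"
    using S2 T2 cG assms by auto
  have "(\<Sum>v\<in>?G. ?h v) = real c * D / real k ^ m * (\<Sum>u\<in>S. stay2 (torus m k) S u) +
      (real N - real c) * D / real l ^ m * (\<Sum>u\<in>T. stay2 (torus m l) T u)"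
    unfolding D_def using assms by (intro sum_glue) auto
  also have "(\<Sum>u\<in>S. stay2 (torus m k) S u) = real k ^ m / 2 * P2 (torus m k) S"
    using P2_eq_sum[OF fin(1) ne(1), of "torus m k"] assms(2) by (simp add: cS field_simps)
  also have "(\<Sum>u\<in>T. stay2 (torus m l) T u) = real l ^ m / 2 * P2 (torus m l) T"
    using P2_eq_sum[OF fin(2) ne(2), of "torus m l"] assms(3) by (simp add: cS field_simps)
  finally have "(\<Sum>v\<in>?G. ?h v) =
      real c * D / 2 * P2 (torus m k) S + (real N - real c) * D / 2 * P2 (torus m l) T"
    using assms(2,3) by simp
  \<comment> \<open>Division by \<open>N * D / 2\<close> turns the slab widths \<open>c\<close> and
    \<open>N - c\<close> into the weights.\<close>
  then have h: "(\<Sum>v\<in>?G. ?h v) / card ?G = c / N * P2 (torus m k) S + (1 - c / N) * P2 (torus m l) T"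
    using D assms(9) by (simp add: cG' field_simps)
  have "\<bar>(\<Sum>v\<in>?G. ?s v) - (\<Sum>v\<in>?G. ?h v)\<bar> \<le> (\<Sum>v\<in>?G. \<bar>?s v - ?h v\<bar>)"
    unfolding sum_subtractf[symmetric] by (rule sum_abs)
  also have "\<dots> \<le> (\<Sum>v\<in>?G. if v 1 \<in> X then 1 else 0)"
  proof (rule sum_mono)
    fix v assume "v \<in> ?G"
    then have v: "v \<in> {1..m} \<rightarrow>\<^sub>E {1..N}" by (simp add: glue_def)
    then have v1: "v 1 \<in> {1..N}" using assms(1) by (auto simp: PiE_iff)
    show "\<bar>?s v - ?h v\<bar> \<le> (if v 1 \<in> X then 1 else 0)"
    proof (cases "v 1 \<in> X")
      case True
      have "0 \<le> ?h v" "?h v \<le> 1" by (simp_all add: stay2_range)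
      then show ?thesis using True stay2_range[of "torus m N" ?G v] by simp
    next
      case False
      then have "v 1 \<notin> {1, 2, c - 1, c, c + 1, c + 2, N - 1, N}"
        using v1 unfolding X_def by blast
      then have "?s v = ?h v"
        by (rule stay2_glue[OF assms(1-5) N2 v])
      then show ?thesis by simp
    qed
  qed
  also have "\<dots> = real (card (?G \<inter> {v. v 1 \<in> X}))"
    using finite_glue by (simp add: sum.If_cases)
  also have "\<dots> \<le> real (card {v \<in> {1..m} \<rightarrow>\<^sub>E {1..N}. v 1 \<in> X})"
  proof -
    have "finite {v \<in> {1..m} \<rightarrow>\<^sub>E {1..N}. v 1 \<in> X}"
      by (rule finite_subset[of _ "{1..m} \<rightarrow>\<^sub>E {1..N}"]) (auto intro: finite_PiE)
    moreover have "?G \<inter> {v. v 1 \<in> X} \<subseteq> {v \<in> {1..m} \<rightarrow>\<^sub>E {1..N}. v 1 \<in> X}"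
      unfolding glue_def by blast
    ultimately show ?thesis by (simp only: of_nat_le_iff card_mono)
  qed
  also have "\<dots> = real (card X) * D"
    using assms(1) by (subst card_slab) (auto simp: X_def D_def)
  also have "\<dots> \<le> 8 * D"
  proof -
    have "card X \<le> card {1, 2, c - 1, c, c + 1, c + 2, N - 1, N}"
      by (simp only: X_def) (intro card_mono; simp)
    \<comment> \<open>The length of the list bounds the cardinality even if some of the eight values
      coincide.\<close>
    also have "\<dots> \<le> length [1, 2, c - 1, c, c + 1, c + 2, N - 1, N]"
      using card_length[of "[1, 2, c - 1, c, c + 1, c + 2, N - 1, N]"] by simp
    finally show ?thesis using D by simp
  qed
  finally have "\<bar>(\<Sum>v\<in>?G. ?s v) - (\<Sum>v\<in>?G. ?h v)\<bar> / card ?G \<le> 8 * D / card ?G"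
    by (rule divide_right_mono) simp
  also have "8 * D / card ?G = 16 / N"
    using D by (simp add: cG')
  also have "\<bar>(\<Sum>v\<in>?G. ?s v) - (\<Sum>v\<in>?G. ?h v)\<bar> / card ?G =
      \<bar>(\<Sum>v\<in>?G. ?s v) / card ?G - (\<Sum>v\<in>?G. ?h v) / card ?G\<bar>"
    by (simp add: diff_divide_distrib[symmetric])
  finally show ?thesis
    unfolding h P2_eq_sum[OF finite_glue ne(3)] .
qed

section \<open>Balanced colourings of tori\<close>

lemma balanced_colouring_torus_iff:
  "balanced_colouring (torus m k) R B \<longleftrightarrow>
    R \<subseteq> {1..m} \<rightarrow>\<^sub>E {1..k} \<and> B = ({1..m} \<rightarrow>\<^sub>E {1..k}) - R \<and> 2 * card R = k ^ m \<and> 2 * card B = k ^ m"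
proof -
  let ?V = "{1..m} \<rightarrow>\<^sub>E {1..k}"
  have V: "finite ?V" "card ?V = k ^ m" by (auto intro: finite_PiE simp: card_PiE)
  have card: "card R + card (?V - R) = k ^ m" if "R \<subseteq> ?V"
    using that V by (metis card_Diff_subset card_mono finite_subset le_add_diff_inverse)
  show ?thesis
  proof
    assume "balanced_colouring (torus m k) R B"
    then have RB: "R \<union> B = ?V" "R \<inter> B = {}" "card R = card B"
      by (simp_all add: balanced_colouring_def torus_def)
    then have "R \<subseteq> ?V" "B = ?V - R" by blast+
    then show "R \<subseteq> ?V \<and> B = ?V - R \<and> 2 * card R = k ^ m \<and> 2 * card B = k ^ m"
      using card RB(3) by (simp only: mult_2 simp_thms)
  qed (auto simp: balanced_colouring_def torus_def)
qed

lemma balanced_colouring_torusD: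
  assumes "balanced_colouring (torus m k) R B"
  shows "R \<subseteq> {1..m} \<rightarrow>\<^sub>E {1..k}" "B \<subseteq> {1..m} \<rightarrow>\<^sub>E {1..k}" "2 * card R = k ^ m" "2 * card B = k ^ m"
  using assms unfolding balanced_colouring_torus_iff by blast+

text \<open>For \<open>k = 1\<close> a colour class would satisfy
  \<open>2 * card R = 1\<close>.\<close>

lemma balanced_colouring_torus_ge_2:
  assumes "k \<ge> 1" "balanced_colouring (torus m k) R B"
  shows "k \<ge> 2"
proof (rule ccontr)
  assume "\<not> k \<ge> 2"
  then have "k = 1" using assms by simp
  then show False using assms by (simp add: balanced_colouring_torus_iff)
qed

text \<open>Pull-back commutes with complements and both colours use the same cut, so the glued
  classes are complementary; \<open>card_glue\<close> applied to each colour gives balance.\<close>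

lemma balanced_colouring_glue:
  assumes "m \<ge> 1" "k \<ge> 1" "l \<ge> 1" "k dvd N" "l dvd N" "k dvd c" "l dvd c" "c \<le> N"
    and RB: "balanced_colouring (torus m k) R B" and RB': "balanced_colouring (torus m l) R' B'"
  shows "balanced_colouring (torus m N) (glue m k l N c R R') (glue m k l N c B B')"
proof -
  note D = balanced_colouring_torusD[OF RB] and D' = balanced_colouring_torusD[OF RB']
  have "glue m k l N c B B' = ({1..m} \<rightarrow>\<^sub>E {1..N}) - glue m k l N c R R'"
    using RB RB' assms(2,3) torus_proj_mem
    by (auto simp: glue_def balanced_colouring_torus_iff simp del: One_nat_def split: if_splits)
  moreover have "2 * card (glue m k l N c R R') = N ^ m" "2 * card (glue m k l N c B B') = N ^ m"
    using card_glue[OF assms(1-8) D(1) D'(1) D(3) D'(3)] card_glue[OF assms(1-8) D(2) D'(2) D(4) D'(4)] .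
  ultimately show ?thesis by (auto simp: balanced_colouring_torus_iff glue_def)
qed

section \<open>Approximation of a convex combination\<close>

text \<open>Three errors add up: at most \<open>16 * \<delta>\<close> from gluing, at most
  \<open>\<delta>\<close> from replacing \<alpha> by \<open>t\<close> because \<open>p\<close> and
  \<open>q\<close> lie in the unit interval, and less than \<open>\<epsilon> / 2\<close> from the
  given approximations.\<close>

lemma convex_combination_close:
  fixes p q x y s t \<alpha> \<delta> \<epsilon> :: real
  assumes "\<bar>p - x\<bar> < \<epsilon> / 2" "\<bar>q - y\<bar> < \<epsilon> / 2" "0 \<le> p" "p \<le> 1" "0 \<le> q" "q \<le> 1" "0 \<le> \<alpha>" "\<alpha> \<le> 1"
    and "\<bar>t - \<alpha>\<bar> \<le> \<delta>" "\<bar>s - (t * p + (1 - t) * q)\<bar> \<le> 16 * \<delta>" "17 * \<delta> \<le> \<epsilon> / 2"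
  shows "\<bar>s - (\<alpha> * x + (1 - \<alpha>) * y)\<bar> < \<epsilon>"
proof -
  have "\<bar>\<alpha> * (p - x) + (1 - \<alpha>) * (q - y)\<bar> \<le> \<alpha> * \<bar>p - x\<bar> + (1 - \<alpha>) * \<bar>q - y\<bar>"
    using assms(7,8) abs_triangle_ineq[of "\<alpha> * (p - x)" "(1 - \<alpha>) * (q - y)"] by (simp add: abs_mult)
  also have "\<dots> < \<epsilon> / 2"
    using assms by (intro convex_bound_lt) auto
  finally have 1: "\<bar>\<alpha> * (p - x) + (1 - \<alpha>) * (q - y)\<bar> < \<epsilon> / 2" .
  have "\<bar>(t - \<alpha>) * (p - q)\<bar> \<le> \<delta> * 1"
    unfolding abs_mult using assms by (intro mult_mono) auto
  then have 2: "\<bar>(t - \<alpha>) * (p - q)\<bar> \<le> \<delta>" by simp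
  have "s - (\<alpha> * x + (1 - \<alpha>) * y) =
      (s - (t * p + (1 - t) * q)) + (t - \<alpha>) * (p - q) + (\<alpha> * (p - x) + (1 - \<alpha>) * (q - y))"
    by (simp add: algebra_simps)
  then show ?thesis using 1 2 assms(10,11) by linarith
qed

theorem theorem2:
  fixes m :: nat
  assumes "m \<ge> 2"
  shows "convex (P_region (\<lambda>k. torus m k))"
proof (rule convexI)
  fix z w :: "real \<times> real" and \<alpha> \<mu> :: real
  assume z: "z \<in> P_region (torus m)" and w: "w \<in> P_region (torus m)"
    and "0 \<le> \<alpha>" "0 \<le> \<mu>" "\<alpha> + \<mu> = 1"
  then have \<alpha>: "0 \<le> \<alpha>" "\<alpha> \<le> 1" and \<mu>: "\<mu> = 1 - \<alpha>" by auto
  obtain x y x' y' where zw: "z = (x, y)" "w = (x', y')" by fastforce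
  have "\<exists>N\<ge>1. \<exists>R B. balanced_colouring (torus m N) R B \<and>
      \<bar>P2 (torus m N) R - (\<alpha> * x + (1 - \<alpha>) * x')\<bar> < \<epsilon> \<and>
      \<bar>P2 (torus m N) B - (\<alpha> * y + (1 - \<alpha>) * y')\<bar> < \<epsilon>" if "\<epsilon> > 0" for \<epsilon>
  proof -
    from that have "\<epsilon> / 2 > 0" by simp
    with z obtain k R B where k1: "k \<ge> 1" and RB: "balanced_colouring (torus m k) R B"
      and xy: "\<bar>P2 (torus m k) R - x\<bar> < \<epsilon> / 2" "\<bar>P2 (torus m k) B - y\<bar> < \<epsilon> / 2"
      unfolding P_region_def zw by blast
    from w \<open>\<epsilon> / 2 > 0\<close> obtain l R' B' where l1: "l \<ge> 1" and RB': "balanced_colouring (torus m l) R' B'"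
      and xy': "\<bar>P2 (torus m l) R' - x'\<bar> < \<epsilon> / 2" "\<bar>P2 (torus m l) B' - y'\<bar> < \<epsilon> / 2"
      unfolding P_region_def zw by blast
    have k2: "k \<ge> 2" and l2: "l \<ge> 2"
      using balanced_colouring_torus_ge_2 k1 l1 RB RB' by blast+
    \<comment> \<open>The bound is chosen for \<open>17 / M \<le> \<epsilon> / 2\<close>; the
      maximum with 0 makes \<open>M\<close> positive.\<close>
    obtain M :: nat where M: "M > 0" "34 / \<epsilon> < M"
      using reals_Archimedean2[of "max 0 (34 / \<epsilon>)"] by auto
    \<comment> \<open>The weight \<alpha> is rounded down to a multiple of \<open>1 / M\<close>.
      Scaling \<open>a\<close> and \<open>M\<close> by \<open>k * l\<close> below keeps the ratio
      and makes the cut and the side divisible by both \<open>k\<close> and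
      \<open>l\<close>.\<close>
    define a where "a = nat \<lfloor>\<alpha> * M\<rfloor>"
    have a: "real a \<le> \<alpha> * M" "\<alpha> * M < real a + 1"
      using \<alpha> by (simp_all add: a_def)
    have "\<alpha> * M \<le> 1 * real M" using \<alpha> by (intro mult_right_mono) auto
    then have aM: "a \<le> M" using a by linarith
    define N where "N = M * (k * l)"
    define c where "c = a * (k * l)"
    have kl: "k * l \<ge> 1" using k1 l1 by simp
    have N: "N > 0" "c \<le> N" "k dvd N" "l dvd N" "k dvd c" "l dvd c"
      using M aM kl by (auto simp: N_def c_def)
    have cN: "real c / real N = a / M"
      using kl by (simp add: c_def N_def)
    have "\<alpha> - a / M = (\<alpha> * M - a) / M"
      using M by (simp add: field_simps)
    then have t: "\<bar>real c / real N - \<alpha>\<bar> \<le> 1 / M"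
      unfolding cN using a M by (simp add: abs_minus_commute[of _ \<alpha>] divide_right_mono)
    have "M \<le> N" using kl by (simp add: N_def)
    then have NM: "16 / real N \<le> 16 * (1 / M)"
      using M by (simp add: frac_le)
    have small: "17 * (1 / M) \<le> \<epsilon> / 2"
      using M that by (simp add: field_simps)
    have m: "m \<ge> 1" using assms by simp
    let ?R = "glue m k l N c R R'" and ?B = "glue m k l N c B B'"
    note D = balanced_colouring_torusD[OF RB] and D' = balanced_colouring_torusD[OF RB']
    \<comment> \<open>The common cut \<open>c\<close> gives both colours the same weight
      \<open>c / N\<close>, so both coordinates of the point are combined alike.\<close>
    have "\<bar>P2 (torus m N) ?R - (c / N * P2 (torus m k) R + (1 - c / N) * P2 (torus m l) R')\<bar> \<le> 16 / N"
      "\<bar>P2 (torus m N) ?B - (c / N * P2 (torus m k) B + (1 - c / N) * P2 (torus m l) B')\<bar> \<le> 16 / N"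
      using P2_glue[OF m k2 l2 N(3-6,2,1) D(1) D'(1) D(3) D'(3)]
        P2_glue[OF m k2 l2 N(3-6,2,1) D(2) D'(2) D(4) D'(4)] .
    note close = order_trans[OF this(1) NM] order_trans[OF this(2) NM]
    have "balanced_colouring (torus m N) ?R ?B"
      using m k1 l1 N RB RB' by (intro balanced_colouring_glue) auto
    moreover have "\<bar>P2 (torus m N) ?R - (\<alpha> * x + (1 - \<alpha>) * x')\<bar> < \<epsilon>"
      using convex_combination_close[OF xy(1) xy'(1) P2_range P2_range \<alpha> t close(1) small] .
    moreover have "\<bar>P2 (torus m N) ?B - (\<alpha> * y + (1 - \<alpha>) * y')\<bar> < \<epsilon>"
      using convex_combination_close[OF xy(2) xy'(2) P2_range P2_range \<alpha> t close(2) small] .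
    moreover have "N \<ge> 1" using N by simp
    ultimately show ?thesis by blast
  qed
  then show "\<alpha> *\<^sub>R z + \<mu> *\<^sub>R w \<in> P_region (torus m)"
    by (simp add: P_region_def zw \<mu>)
qed

end
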